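(* There are absolute constants $K_*\geq 1$ and $A>0$ such that for every $K\ge K_*$ there is $\varepsilon_*=\varepsilon_*(K)>0$ such that for every $0<\varepsilon\le\varepsilon_*$ the following holds. Let $(a,b,c,d,\tilde a):[0,+\infty)\to\mathbb{R}^5$ be the solution of the ODE system \begin{align*} \partial_ta&=-\varepsilon^{-2}cd-\varepsilon ab-\varepsilon^2\exp(-K^{10})ac,\\ \partial_tb&=\varepsilon a^2-\varepsilon^{-1}K^{10}c^2,\\ \partial_tc&=\varepsilon^2\exp(-K^{10})a^2+\varepsilon^{-1}K^{10}bc,\\ \partial_td&=\varepsilon^{-2}ca-Kd\tilde a,\\ \partial_t\tilde a&=Kd^2, \end{align*} with initial data $a(0)=1$, $b(0)=c(0)=d(0)=\tilde a(0)=0$. Then there exists a time $t_c$ with $|t_c-\sqrt2|\le A/\sqrt K$ such that $$|a(t)-1|\le AK^{-10}\quad\text{and}\quad|b(t)|,|c(t)|,|d(t)|,|\tilde a(t)|\le AK^{-10}\qquad\text{for }0\le t\le t_c-1/\sqrt K,$$ and $$|\tilde a(t)-1|\le AK^{-10}\quad\text{and}\quad|a(t)|,|b(t)|,|c(t)|,|d(t)|\le AK^{-10}\qquad\text{for }t\ge t_c+1/\sqrt K.$$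
   Context: The system is globally well posed, since it preserves $a^2+b^2+c^2+d^2+\tilde a^2$. The constant $A$ makes explicit the absolute implied constants in the $O(\cdot)$ notation. *)

theory Defs
  imports Complex_Main
begin

text \<open>\<open>e\<close> plays the role of the small parameter \<open>\<epsilon>\<close>, and \<open>a'\<close> that of the fifth component
  \<open>a\<close>-tilde. The components are total functions whose values at negative times are
  irrelevant; the derivative at time \<open>0\<close> is one-sided.\<close>

definition gate_solution ::
  "real \<Rightarrow> real \<Rightarrow> (real \<Rightarrow> real) \<Rightarrow> (real \<Rightarrow> real) \<Rightarrow> (real \<Rightarrow> real) \<Rightarrow> (real \<Rightarrow> real) \<Rightarrow> (real \<Rightarrow> real) \<Rightarrow> bool"
where
  "gate_solution K e a b c d a' \<longleftrightarrow>
     (\<forall>t\<ge>0.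
       (a has_real_derivative
          - (c t * d t / e ^ 2) - e * a t * b t - e ^ 2 * exp (- (K ^ 10)) * a t * c t)
          (at t within {0..}) \<and>
       (b has_real_derivative
          e * (a t) ^ 2 - K ^ 10 / e * (c t) ^ 2)
          (at t within {0..}) \<and>
       (c has_real_derivative
          e ^ 2 * exp (- (K ^ 10)) * (a t) ^ 2 + K ^ 10 / e * b t * c t)
          (at t within {0..}) \<and>
       (d has_real_derivative
          c t * a t / e ^ 2 - K * d t * a' t)
          (at t within {0..}) \<and>
       (a' has_real_derivative
          K * (d t) ^ 2)
          (at t within {0..})) \<and>
     a 0 = 1 \<and> b 0 = 0 \<and> c 0 = 0 \<and> d 0 = 0 \<and> a' 0 = 0"

end

theory Submission
  imports Defs "HOL-Analysis.Analysis" "HOL-Real_Asymp.Real_Asymp"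
begin

text \<open>
  Put \<open>\<beta> = b / e\<close>, \<open>\<gamma> = c / e\<^sup>2\<close> and \<open>M = K ^ 10\<close>. For \<open>e\<close> tiny the drain term in the equation for
  \<open>\<beta>\<close> is negligible up to time \<open>2\<close>, so \<open>\<beta> \<approx> t\<close> as long as \<open>a \<approx> 1\<close> and \<open>\<gamma>\<close> behaves like
  \<open>exp (M * (t\<^sup>2 / 2 - 1))\<close>: it is negligible at distance \<open>x\<close> before \<open>sqrt 2\<close> and enormous at distance
  \<open>x\<close> after it, where \<open>x = 1 / (4 * sqrt K)\<close>. Hence \<open>tc = sqrt 2\<close> works. While \<open>\<gamma>\<close> is enormous, the
  rotation between \<open>a\<close> and \<open>d\<close> equidistributes \<open>a\<^sup>2\<close> and \<open>d\<^sup>2\<close>, so \<open>w\<close>, which is \<open>a\<close>-tilde, obeys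
  \<open>w' \<approx> K / 2 * (1 - w\<^sup>2)\<close> and is within \<open>exp (- 3 * sqrt K / 8)\<close>, up to constants, of \<open>1\<close> at time
  \<open>sqrt 2 + 1 / sqrt K\<close>. Since \<open>a\<close>-tilde is nondecreasing, energy conservation gives the bounds at
  all later times.
\<close>

section \<open>Comparison for scalar differential inequalities\<close>

text \<open>Gronwall by an integrating factor: with \<open>P\<close> a primitive of
  \<open>p\<close>, the product \<open>f * exp (- P)\<close> has nonnegative derivative. Below,
  \<open>f\<close> is mostly the gap between a component and an explicit barrier.\<close>

lemma nonneg_of_linear_differential_inequality:
  fixes f f' p :: "real \<Rightarrow> real"
  assumes "x \<le> y" and sub: "{x..y} \<subseteq> S"
    and p: "continuous_on {x..y} p"
    and f: "\<And>t. t \<in> {x..y} \<Longrightarrow> (f has_real_derivative f' t) (at t within S)"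
    and ge: "\<And>t. t \<in> {x..y} \<Longrightarrow> f' t \<ge> p t * f t"
    and "f x \<ge> 0"
  shows "f y \<ge> 0"
proof -
  define P where "P t = integral {x..t} p" for t
  have P: "(P has_real_derivative p t) (at t within {x..y})" if "t \<in> {x..y}" for t
    unfolding P_def using integral_has_real_derivative[OF p that] .
  define g where "g t = f t * exp (- P t)" for t
  have g: "(g has_real_derivative (f' t - p t * f t) * exp (- P t)) (at t within {x..y})"
    if t: "t \<in> {x..y}" for t
    unfolding g_def
    by (rule derivative_eq_intros refl DERIV_subset[OF f[OF t] sub] P[OF t])+
      (simp add: algebra_simps)
  obtain u where u: "u \<in> {x..y}"
    "g y - g x = (f' u - p u * f u) * exp (- P u) * (y - x)"
    using mvt_very_simple[OF \<open>x \<le> y\<close>,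
        of g "\<lambda>t. (*) ((f' t - p t * f t) * exp (- P t))"] g
    unfolding has_field_derivative_def by auto
  have "g y - g x \<ge> 0"
    unfolding u(2) using ge[OF u(1)] \<open>x \<le> y\<close> by (intro mult_nonneg_nonneg) auto
  moreover have "g x \<ge> 0"
    unfolding g_def using \<open>f x \<ge> 0\<close> by simp
  ultimately have "f y * exp (- P y) \<ge> 0"
    unfolding g_def by linarith
  then show ?thesis
    by (simp add: zero_le_mult_iff)
qed

lemma le_of_derivative_nonneg:
  fixes f f' :: "real \<Rightarrow> real"
  assumes "x \<le> y" and "{x..y} \<subseteq> S"
    and f: "\<And>t. t \<in> {x..y} \<Longrightarrow> (f has_real_derivative f' t) (at t within S)"
    and "\<And>t. t \<in> {x..y} \<Longrightarrow> f' t \<ge> 0"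
  shows "f x \<le> f y"
proof -
  have "f y - f x \<ge> 0"
    by (rule nonneg_of_linear_differential_inequality
        [where f = "\<lambda>t. f t - f x" and f' = f' and p = "\<lambda>_. 0" and x = x and y = y and S = S])
      (use assms in \<open>auto intro!: derivative_eq_intros\<close>)
  then show ?thesis by simp
qed

text \<open>\<open>w\<close> stands for \<open>a\<close>-tilde; \<open>x\<close> is the distance from \<open>sqrt 2\<close> at which the gate is safely closed
  or open.\<close>

locale rescaled_gate =
  fixes K M e x h :: real and a \<beta> \<gamma> d w :: "real \<Rightarrow> real"
  assumes a_deriv: "t \<ge> 0 \<Longrightarrow> (a has_real_derivative
        - (\<gamma> t * d t) - e ^ 2 * a t * \<beta> t - e ^ 4 * exp (- M) * a t * \<gamma> t) (at t within {0..})"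
    and \<beta>_deriv: "t \<ge> 0 \<Longrightarrow> (\<beta> has_real_derivative
        (a t) ^ 2 - e ^ 2 * M * (\<gamma> t) ^ 2) (at t within {0..})"
    and \<gamma>_deriv: "t \<ge> 0 \<Longrightarrow> (\<gamma> has_real_derivative
        exp (- M) * (a t) ^ 2 + M * \<beta> t * \<gamma> t) (at t within {0..})"
    and d_deriv: "t \<ge> 0 \<Longrightarrow> (d has_real_derivative
        \<gamma> t * a t - K * d t * w t) (at t within {0..})"
    and w_deriv: "t \<ge> 0 \<Longrightarrow> (w has_real_derivative K * (d t) ^ 2) (at t within {0..})"
    and init: "a 0 = 1" "\<beta> 0 = 0" "\<gamma> 0 = 0" "d 0 = 0" "w 0 = 0"
    and K: "K \<ge> 1" and M: "M \<ge> 4"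
    and e: "0 < e" "e \<le> exp (- (4 * M))"
    and x: "0 < x" "x \<le> 1 / 4"
    and h_def: "h = exp (- (M * x))"
    and h_small: "20 * M * h \<le> 1"
begin

lemmas derivs = a_deriv \<beta>_deriv \<gamma>_deriv d_deriv w_deriv

section \<open>Conserved energy and a priori bounds\<close>

text \<open>The terms of the derivative cancel in pairs; the weights \<open>e ^ 2\<close> and
  \<open>e ^ 4\<close> undo the rescaling of \<open>b\<close> and \<open>c\<close>.\<close>

lemma energy:
  assumes "t \<ge> 0"
  shows "(a t)\<^sup>2 + e ^ 2 * (\<beta> t)\<^sup>2 + e ^ 4 * (\<gamma> t)\<^sup>2 + (d t)\<^sup>2 + (w t)\<^sup>2 = 1"
proof -
  define E where "E t = (a t)\<^sup>2 + e ^ 2 * (\<beta> t)\<^sup>2 + e ^ 4 * (\<gamma> t)\<^sup>2 + (d t)\<^sup>2 + (w t)\<^sup>2" for t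
  have E: "(E has_real_derivative 0) (at t within {0..})" if t: "t \<ge> 0" for t
    unfolding E_def
    by (rule derivative_eq_intros refl derivs[OF t])+
      (simp add: field_simps power2_eq_square power4_eq_xxxx)
  have "E 0 \<le> E t"
    by (rule le_of_derivative_nonneg[where f' = "\<lambda>_. 0" and S = "{0..}"]) (use E assms in auto)
  moreover have "- E 0 \<le> - E t"
    by (rule le_of_derivative_nonneg[where f = "\<lambda>t. - E t" and f' = "\<lambda>_. 0" and S = "{0..}"])
      (use E assms in \<open>auto intro!: derivative_eq_intros\<close>)
  ultimately show ?thesis
    by (simp add: E_def init)
qed

lemma squares_le_1:
  assumes "t \<ge> 0"
  shows "(a t)\<^sup>2 \<le> 1" "(d t)\<^sup>2 \<le> 1" "(w t)\<^sup>2 \<le> 1"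
proof -
  have "0 \<le> e ^ 2 * (\<beta> t)\<^sup>2" "0 \<le> e ^ 4 * (\<gamma> t)\<^sup>2" by simp_all
  then show "(a t)\<^sup>2 \<le> 1" "(d t)\<^sup>2 \<le> 1" "(w t)\<^sup>2 \<le> 1"
    using energy[OF assms] zero_le_power2[of "a t"] zero_le_power2[of "d t"]
      zero_le_power2[of "w t"] by linarith+
qed

lemma abs_le_1:
  assumes "t \<ge> 0"
  shows "\<bar>a t\<bar> \<le> 1" "\<bar>d t\<bar> \<le> 1" "\<bar>w t\<bar> \<le> 1"
  using squares_le_1[OF assms] by (simp_all add: abs_square_le_1)

lemma w_mono:
  assumes "0 \<le> t" "t \<le> u"
  shows "w t \<le> w u"
  by (rule le_of_derivative_nonneg[where f' = "\<lambda>t. K * (d t)\<^sup>2" and S = "{0..}"])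
    (use assms w_deriv K in auto)

lemma w_nonneg: "t \<ge> 0 \<Longrightarrow> w t \<ge> 0"
  using w_mono[of 0 t] init by simp

lemma \<beta>_le:
  assumes "t \<ge> 0"
  shows "\<beta> t \<le> t"
proof -
  have "0 - \<beta> 0 \<le> t - \<beta> t"
  proof (rule le_of_derivative_nonneg[where f = "\<lambda>t. t - \<beta> t" and S = "{0..}"
        and f' = "\<lambda>t. 1 - ((a t)\<^sup>2 - e ^ 2 * M * (\<gamma> t) ^ 2)"])
    fix u assume "u \<in> {0..t}"
    then have u: "u \<ge> 0" by simp
    show "((\<lambda>t. t - \<beta> t) has_real_derivative 1 - ((a u)\<^sup>2 - e ^ 2 * M * (\<gamma> u) ^ 2)) (at u within {0..})"
      by (rule derivative_eq_intros refl derivs[OF u])+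
    have "0 \<le> e ^ 2 * M * (\<gamma> u) ^ 2" using M by simp
    then show "0 \<le> 1 - ((a u)\<^sup>2 - e ^ 2 * M * (\<gamma> u) ^ 2)"
      using squares_le_1[OF u] by linarith
  qed (use assms in auto)
  then show ?thesis by (simp add: init)
qed

lemma \<gamma>_nonneg:
  assumes "t \<ge> 0"
  shows "\<gamma> t \<ge> 0"
proof (rule nonneg_of_linear_differential_inequality[where x = 0 and S = "{0..}" and f = \<gamma>
      and f' = "\<lambda>t. exp (- M) * (a t) ^ 2 + M * \<beta> t * \<gamma> t" and p = "\<lambda>t. M * \<beta> t"])
  have "continuous_on {0..} \<beta>"
    by (rule DERIV_continuous_on, rule \<beta>_deriv) simp
  then show "continuous_on {0..t} (\<lambda>t. M * \<beta> t)"
    by (intro continuous_intros) (auto intro: continuous_on_subset)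
qed (use assms \<gamma>_deriv init in auto)

text \<open>The barrier \<open>y\<close> on the right solves
  \<open>y' = exp (M * (t^2 / 2 - 1)) + M * t * y\<close>. Its source dominates
  \<open>exp (- M) * a^2\<close> because \<open>a^2 \<le> 1\<close>, and its rate
  \<open>M * t\<close> dominates \<open>M * \<beta>\<close> by \<open>\<beta>_le\<close>.\<close>

lemma \<gamma>_le:
  assumes "t \<ge> 0"
  shows "\<gamma> t \<le> t * exp (M * (t\<^sup>2 / 2 - 1))"
proof -
  have "t * exp (M * (t\<^sup>2 / 2 - 1)) - \<gamma> t \<ge> 0"
  proof (rule nonneg_of_linear_differential_inequality[where x = 0 and S = "{0..}"
        and f = "\<lambda>t. t * exp (M * (t\<^sup>2 / 2 - 1)) - \<gamma> t" and p = "\<lambda>t. M * t"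
        and f' = "\<lambda>t. exp (M * (t\<^sup>2 / 2 - 1)) + M * t * (t * exp (M * (t\<^sup>2 / 2 - 1)))
                     - (exp (- M) * (a t) ^ 2 + M * \<beta> t * \<gamma> t)"])
    fix u assume "u \<in> {0..t}"
    then have u: "u \<ge> 0" by simp
    show "((\<lambda>t. t * exp (M * (t\<^sup>2 / 2 - 1)) - \<gamma> t) has_real_derivative
        exp (M * (u\<^sup>2 / 2 - 1)) + M * u * (u * exp (M * (u\<^sup>2 / 2 - 1)))
          - (exp (- M) * (a u) ^ 2 + M * \<beta> u * \<gamma> u)) (at u within {0..})"
      by (rule derivative_eq_intros refl derivs[OF u] | simp)+
    have "exp (- M) * (a u)\<^sup>2 \<le> exp (- M) * 1"
      using squares_le_1[OF u] by (intro mult_left_mono) auto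
    also have "\<dots> \<le> exp (M * (u\<^sup>2 / 2 - 1))"
      using M by (simp add: algebra_simps)
    finally have "exp (- M) * (a u)\<^sup>2 \<le> exp (M * (u\<^sup>2 / 2 - 1))" .
    moreover have "M * \<beta> u * \<gamma> u \<le> M * u * \<gamma> u"
      using \<beta>_le[OF u] \<gamma>_nonneg[OF u] M by (intro mult_right_mono mult_left_mono) auto
    ultimately show "M * u * (u * exp (M * (u\<^sup>2 / 2 - 1)) - \<gamma> u)
        \<le> exp (M * (u\<^sup>2 / 2 - 1)) + M * u * (u * exp (M * (u\<^sup>2 / 2 - 1)))
          - (exp (- M) * (a u) ^ 2 + M * \<beta> u * \<gamma> u)"
      unfolding right_diff_distrib by linarith
  qed (use assms init in \<open>auto intro!: continuous_intros\<close>)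
  then show ?thesis by simp
qed

section \<open>Effects of the small parameter up to time 2\<close>

lemma exp_M_bounds: "exp (- M) \<le> h" "exp (- M) \<le> 1 / 2" "M * exp (- M) \<le> 1"
proof -
  have "M * x \<le> M * 1" using M x by (intro mult_left_mono) auto
  then show "exp (- M) \<le> h" unfolding h_def by simp
  have *: "1 + M \<le> exp M" by (rule exp_ge_add_one_self)
  then show "exp (- M) \<le> 1 / 2" "M * exp (- M) \<le> 1"
    using M order_trans[OF _ *, of 2] order_trans[OF _ *, of M]
    by (simp_all add: exp_minus field_simps)
qed

lemma h_pos: "0 < h" and h_le: "h \<le> 1 / 20"
proof -
  show "0 < h" by (simp add: h_def)
  then have "1 * h \<le> M * h" using M by (intro mult_right_mono) auto
  then show "h \<le> 1 / 20" using h_small by linarith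
qed

lemma \<gamma>_le_exp_M:
  assumes "0 \<le> t" "t \<le> 2"
  shows "\<gamma> t \<le> 2 * exp M"
proof -
  have "t\<^sup>2 \<le> 2\<^sup>2" using assms by (intro power_mono) auto
  then have "M * (t\<^sup>2 / 2 - 1) \<le> M * 1" using M by (intro mult_left_mono) auto
  then have "t * exp (M * (t\<^sup>2 / 2 - 1)) \<le> 2 * exp M"
    using assms by (intro mult_mono) auto
  then show ?thesis using \<gamma>_le[OF assms(1)] by linarith
qed

lemma e_le: "e \<le> exp (- M) ^ 4"
  using e by (simp add: flip: exp_of_nat_mult)

text \<open>The bound on \<open>e\<close> supplies four factors \<open>exp (- M)\<close>, of which
  \<open>\<gamma> \<le> 2 * exp M\<close> uses up only one.\<close>

lemma e_\<gamma>_small: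
  assumes "0 \<le> t" "t \<le> 2"
  shows "e * \<gamma> t \<le> 2 * exp (- M) ^ 3"
proof -
  have "e * \<gamma> t \<le> exp (- M) ^ 4 * (2 * exp M)"
    using e_le e \<gamma>_le_exp_M[OF assms] \<gamma>_nonneg[OF assms(1)] by (intro mult_mono) auto
  also have "\<dots> = 2 * exp (- M) ^ 3"
    by (simp add: exp_minus field_simps eval_nat_numeral)
  finally show ?thesis .
qed

text \<open>Writing the drain of \<beta> as \<open>M * (e * \<gamma>)^2\<close> gives six factors
  \<open>q = exp (- M)\<close>: one absorbs \<open>M\<close>, four absorb the numerical constant,
  and the last is at most \<open>h\<close>.\<close>

lemma drain_small:
  assumes "0 \<le> t" "t \<le> 2"
  shows "e ^ 2 * M * (\<gamma> t)\<^sup>2 \<le> h"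
proof -
  define q where "q = exp (- M)"
  have q: "0 < q" "q \<le> 1 / 2" "q \<le> h" "M * q \<le> 1"
    using exp_M_bounds by (simp_all add: q_def)
  have "e ^ 2 * M * (\<gamma> t)\<^sup>2 = M * (e * \<gamma> t)\<^sup>2" by (simp add: power_mult_distrib)
  also have "\<dots> \<le> M * (2 * q ^ 3)\<^sup>2"
    using e_\<gamma>_small[OF assms] e \<gamma>_nonneg[OF assms(1)] M
    by (intro mult_left_mono power_mono) (auto simp: q_def)
  also have "\<dots> = (M * q) * (4 * q ^ 4 * q)"
    by (simp add: eval_nat_numeral)
  also have "\<dots> \<le> 1 * (4 * (1 / 2) ^ 4 * q)"
    using q M by (intro mult_mono power_mono) auto
  also have "\<dots> \<le> h" using q by (simp add: eval_nat_numeral)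
  finally show ?thesis .
qed

text \<open>Per unit of time \<beta> gains at least \<open>r\<close> and loses at most
  \<open>h\<close> to the drain. While the gate is closed, \<open>r = 1 - 9 * h\<close> is
  available; where nothing is known about \<open>a\<close>, \<open>r = 0\<close> is used.\<close>

lemma \<beta>_growth:
  assumes "0 \<le> t" "t \<le> u" "u \<le> 2"
    and r: "\<And>z. z \<in> {t..u} \<Longrightarrow> (a z)\<^sup>2 \<ge> r"
  shows "\<beta> u \<ge> \<beta> t + (r - h) * (u - t)"
proof -
  have "\<beta> t - (r - h) * t \<le> \<beta> u - (r - h) * u"
  proof (rule le_of_derivative_nonneg[where f = "\<lambda>t. \<beta> t - (r - h) * t" and S = "{0..}"
        and f' = "\<lambda>t. (a t)\<^sup>2 - e ^ 2 * M * (\<gamma> t) ^ 2 - (r - h)"])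
    fix z assume z: "z \<in> {t..u}"
    then have z0: "z \<ge> 0" using assms by simp
    show "((\<lambda>t. \<beta> t - (r - h) * t) has_real_derivative
        (a z)\<^sup>2 - e ^ 2 * M * (\<gamma> z) ^ 2 - (r - h)) (at z within {0..})"
      by (rule derivative_eq_intros refl derivs[OF z0])+ simp
    show "0 \<le> (a z)\<^sup>2 - e ^ 2 * M * (\<gamma> z) ^ 2 - (r - h)"
      using r[OF z] drain_small[of z] z assms(1,3) by simp
  qed (use assms in auto)
  then show ?thesis by (simp add: algebra_simps)
qed

lemma \<beta>_abs_le:
  assumes "0 \<le> t" "t \<le> 2"
  shows "\<bar>\<beta> t\<bar> \<le> 2"
proof -
  have "\<beta> t \<ge> \<beta> 0 + (0 - h) * (t - 0)" by (rule \<beta>_growth) (use assms in auto)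
  moreover have "h * t \<le> 1 * 2" using assms h_le h_pos by (intro mult_mono) auto
  ultimately show ?thesis using \<beta>_le[of t] assms init by auto
qed

text \<open>The left-hand side is \<open>b^2 + c^2\<close> in the original variables, so up to time
  2 nearly all energy sits in \<open>a\<close>, \<open>d\<close> and \<open>w\<close>.\<close>

lemma b_c_small:
  assumes "0 \<le> t" "t \<le> 2"
  shows "e ^ 2 * (\<beta> t)\<^sup>2 + e ^ 4 * (\<gamma> t)\<^sup>2 \<le> h"
proof -
  define q where "q = exp (- M)"
  have q: "0 < q" "q \<le> 1 / 2" "q \<le> h"
    using exp_M_bounds by (simp_all add: q_def)
  have e4: "e \<le> q ^ 4" using e_le by (simp add: q_def)
  have q3: "q ^ 3 \<le> 1 / 8" using power_mono[of q "1/2" 3] q by (simp add: eval_nat_numeral)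
  have "q ^ 4 = q ^ 3 * q" by (simp add: eval_nat_numeral)
  also have "\<dots> \<le> 1 / 8 * q" using q3 q by (intro mult_right_mono) auto
  finally have e_q: "e \<le> q / 8" using e4 by simp
  have "(\<beta> t)\<^sup>2 \<le> 2\<^sup>2" using power_mono[OF \<beta>_abs_le[OF assms], of 2] by simp
  then have 1: "e ^ 2 * (\<beta> t)\<^sup>2 \<le> e ^ 2 * 4" by (intro mult_left_mono) auto
  have "e * \<gamma> t \<le> 1" using e_\<gamma>_small[OF assms] q3 by (simp add: q_def)
  then have "(e * \<gamma> t)\<^sup>2 \<le> 1\<^sup>2" using e \<gamma>_nonneg[OF assms(1)] by (intro power_mono) auto
  then have "e ^ 2 * (e * \<gamma> t)\<^sup>2 \<le> e ^ 2 * 1" by (intro mult_left_mono) auto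
  then have 2: "e ^ 4 * (\<gamma> t)\<^sup>2 \<le> e ^ 2"
    by (simp add: power_mult_distrib eval_nat_numeral mult_ac)
  have "e ^ 2 \<le> (q / 8) * (1 / 16)"
    unfolding power2_eq_square using e_q q e by (intro mult_mono) auto
  then show ?thesis using 1 2 q by linarith
qed

section \<open>The closed gate, up to \<open>sqrt 2 - x\<close>\<close>

lemma sqrt2_bounds: "141 / 100 < sqrt (2::real)" "sqrt (2::real) < 142 / 100"
  by (rule real_less_rsqrt, simp add: power2_eq_square)
    (rule real_less_lsqrt, auto simp: power2_eq_square)

text \<open>In the derivative of \<open>d^2 + w^2\<close> the terms with \<open>K\<close> cancel,
  which leaves the transfer \<open>2 * \<gamma> * a * d\<close>, at most \<open>4 * h\<close>. By
  time 2 this adds up to at most \<open>8 * h\<close>, and \<open>b_c_small\<close> contributes one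
  more \<open>h\<close>.\<close>

lemma gate_closed:
  assumes "0 \<le> t" "t \<le> sqrt 2 - x"
  shows "1 - (a t)\<^sup>2 \<le> 9 * h" and "a t \<ge> 1 - 9 * h"
proof -
  have t2: "t \<le> 2" using assms x sqrt2_bounds by linarith
  have \<gamma>_small: "\<gamma> u \<le> 2 * h" if "u \<in> {0..t}" for u
  proof -
    have u: "0 \<le> u" "u \<le> sqrt 2 - x" using that assms by auto
    have "u\<^sup>2 \<le> (sqrt 2 - x)\<^sup>2" using u by (intro power_mono) auto
    also have "\<dots> = 2 - 2 * sqrt 2 * x + x * x"
      by (simp add: power2_eq_square algebra_simps)
    \<comment> \<open>This makes the exponent in \<open>\<gamma>_le\<close> at most
      \<open>- (M * x)\<close>, whose exponential is \<open>h\<close>.\<close>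
    also have "\<dots> \<le> 2 - 2 * x"
    proof -
      have "x * (2 + x) \<le> x * (2 * sqrt 2)"
        using x sqrt2_bounds by (intro mult_left_mono) auto
      then show ?thesis by (simp add: algebra_simps)
    qed
    finally have "M * (u\<^sup>2 / 2 - 1) \<le> M * (- x)"
      using M by (intro mult_left_mono) auto
    then have "u * exp (M * (u\<^sup>2 / 2 - 1)) \<le> 2 * h"
      unfolding h_def using that t2 by (intro mult_mono) auto
    then show ?thesis using \<gamma>_le[OF u(1)] by linarith
  qed
  have low: "1 - (a u)\<^sup>2 \<le> 9 * h" if ut: "u \<in> {0..t}" for u
  proof -
    have "4 * h * 0 - ((d 0)\<^sup>2 + (w 0)\<^sup>2) \<le> 4 * h * u - ((d u)\<^sup>2 + (w u)\<^sup>2)"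
    proof (rule le_of_derivative_nonneg[where S = "{0..}"
          and f = "\<lambda>t. 4 * h * t - ((d t)\<^sup>2 + (w t)\<^sup>2)"
          and f' = "\<lambda>t. 4 * h - 2 * (d t * a t) * \<gamma> t"])
      fix z assume z: "z \<in> {0..u}"
      then have z0: "z \<ge> 0" by simp
      show "((\<lambda>t. 4 * h * t - ((d t)\<^sup>2 + (w t)\<^sup>2)) has_real_derivative
          4 * h - 2 * (d z * a z) * \<gamma> z) (at z within {0..})"
        by (rule derivative_eq_intros refl derivs[OF z0])+
          (simp add: algebra_simps power2_eq_square)
      have "\<bar>d z * a z\<bar> \<le> 1 * 1"
        unfolding abs_mult using abs_le_1[OF z0] by (intro mult_mono) auto
      then have "(d z * a z) * \<gamma> z \<le> 1 * \<gamma> z"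
        using \<gamma>_nonneg[OF z0] by (intro mult_right_mono) auto
      then show "0 \<le> 4 * h - 2 * (d z * a z) * \<gamma> z"
        using \<gamma>_small[of z] z ut by (simp add: mult_ac)
    qed (use ut in auto)
    then have "(d u)\<^sup>2 + (w u)\<^sup>2 \<le> 4 * h * u" by (simp add: init)
    also have "\<dots> \<le> 4 * h * 2" using ut t2 h_pos by (intro mult_left_mono) auto
    finally show ?thesis using energy[of u] b_c_small[of u] ut t2 by auto
  qed
  show "1 - (a t)\<^sup>2 \<le> 9 * h"
    using low[of t] assms by auto
  \<comment> \<open>The bound on \<open>a^2\<close> leaves the sign open; as
    \<open>9 * h < 1\<close>, \<open>a\<close> cannot vanish on its way from
    \<open>a 0 = 1\<close>.\<close>
  have "a t > 0"
  proof (rule ccontr)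
    assume "\<not> a t > 0"
    moreover have "continuous_on {0..t} a"
      by (rule continuous_on_subset[where s = "{0..}"], rule DERIV_continuous_on, rule a_deriv) auto
    ultimately obtain u where "0 \<le> u" "u \<le> t" "a u = 0"
      using IVT2'[of a t 0 0] assms init by auto
    then show False using low[of u] h_le by auto
  qed
  then have "(a t)\<^sup>2 \<le> a t * 1"
    unfolding power2_eq_square using abs_le_1[OF assms(1)] by (intro mult_left_mono) auto
  then show "a t \<ge> 1 - 9 * h" using \<open>1 - (a t)\<^sup>2 \<le> 9 * h\<close> by simp
qed


section \<open>Growth of \<gamma> across \<open>sqrt 2\<close>\<close>

text \<open>Here \<open>\<beta> \<ge> (1 - 10 * h) * t\<close>: \<open>9 * h\<close> is lost in
  \<open>a^2\<close> and \<open>h\<close> in the drain. The barrier grows at the resulting rate and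
  starts at 0; its prefactor is chosen so that its own source is at most
  \<open>exp (- M) / 2\<close>, hence at most \<open>exp (- M) * a^2\<close>.\<close>

lemma \<gamma>_lower_closed:
  assumes "0 \<le> t" "t \<le> sqrt 2 - x"
  shows "\<gamma> t \<ge> exp (- M) / (4 * M) * (exp (M * (1 - 10 * h) * t\<^sup>2 / 2) - 1)"
proof -
  define p where "p = M * (1 - 10 * h)"
  have p: "0 \<le> p" "p \<le> M"
    unfolding p_def using M h_le h_pos by (auto simp: mult_le_cancel_left2)
  have t2: "t \<le> 2" using assms x sqrt2_bounds by linarith
  have "\<gamma> t - exp (- M) / (4 * M) * (exp (p * t\<^sup>2 / 2) - 1) \<ge> 0"
  proof (rule nonneg_of_linear_differential_inequality[where x = 0 and S = "{0..}"
        and f = "\<lambda>t. \<gamma> t - exp (- M) / (4 * M) * (exp (p * t\<^sup>2 / 2) - 1)" and p = "\<lambda>t. p * t"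
        and f' = "\<lambda>t. exp (- M) * (a t) ^ 2 + M * \<beta> t * \<gamma> t
                     - exp (- M) / (4 * M) * (p * t * exp (p * t\<^sup>2 / 2))"])
    fix u assume u: "u \<in> {0..t}"
    then have u0: "u \<ge> 0" by simp
    show "((\<lambda>t. \<gamma> t - exp (- M) / (4 * M) * (exp (p * t\<^sup>2 / 2) - 1)) has_real_derivative
        exp (- M) * (a u) ^ 2 + M * \<beta> u * \<gamma> u
          - exp (- M) / (4 * M) * (p * u * exp (p * u\<^sup>2 / 2))) (at u within {0..})"
      by (rule derivative_eq_intros refl derivs[OF u0] | simp)+
    have a_low: "(a z)\<^sup>2 \<ge> 1 - 9 * h" if "z \<in> {0..u}" for z
      using gate_closed(1)[of z] that u assms by auto
    have "\<beta> u \<ge> \<beta> 0 + (1 - 9 * h - h) * (u - 0)"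
      by (rule \<beta>_growth) (use u t2 a_low in auto)
    then have "M * ((1 - 10 * h) * u) \<le> M * \<beta> u"
      using M init by (intro mult_left_mono) auto
    then have 1: "p * u * \<gamma> u \<le> M * \<beta> u * \<gamma> u"
      using \<gamma>_nonneg[OF u0] by (intro mult_right_mono) (auto simp: p_def mult.assoc)
    have "p * u \<le> M * 2"
      using p u t2 M by (intro mult_mono) auto
    then have "exp (- M) / (4 * M) * (p * u) \<le> exp (- M) / (4 * M) * (M * 2)"
      using M by (intro mult_left_mono) auto
    also have "\<dots> = exp (- M) * (1 / 2)" using M by simp
    also have "\<dots> \<le> exp (- M) * (a u)\<^sup>2"
      using a_low[of u] u0 h_le by (intro mult_left_mono) auto
    finally have 2: "exp (- M) / (4 * M) * (p * u) \<le> exp (- M) * (a u)\<^sup>2" .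
    show "p * u * (\<gamma> u - exp (- M) / (4 * M) * (exp (p * u\<^sup>2 / 2) - 1))
        \<le> exp (- M) * (a u) ^ 2 + M * \<beta> u * \<gamma> u
          - exp (- M) / (4 * M) * (p * u * exp (p * u\<^sup>2 / 2))"
      using 1 2 by (simp add: algebra_simps)
  qed (use assms init in \<open>auto intro!: continuous_intros\<close>)
  then show ?thesis by (simp add: p_def)
qed

text \<open>The loss \<open>10 * h\<close> in the rate costs less than 1 in the exponent because
  \<open>20 * M * h \<le> 1\<close>, and dropping the subtracted 1 of the barrier costs a factor
  2.\<close>

lemma \<gamma>_lower_at_threshold:
  "\<gamma> (sqrt 2 - x) \<ge> exp (M * ((sqrt 2 - x)\<^sup>2 / 2 - 1) - 1) / (8 * M)"
proof -
  define T where "T = sqrt 2 - x"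
  have T: "1 \<le> T" "T \<le> 142 / 100" using x sqrt2_bounds by (auto simp: T_def)
  have T2: "1 \<le> T\<^sup>2" "T\<^sup>2 \<le> (142 / 100)\<^sup>2"
    using T power_mono[of 1 T 2] power_mono[of T "142/100" 2] by auto
  define y where "y = M * (1 - 10 * h) * T\<^sup>2 / 2"
  have Mh: "(M * h) * T\<^sup>2 \<le> (1 / 20) * (142 / 100)\<^sup>2"
    using h_small M h_pos T2 by (intro mult_mono) auto
  have y: "y \<ge> M * (T\<^sup>2 / 2) - 1"
  proof -
    have "y = M * (T\<^sup>2 / 2) - 5 * ((M * h) * T\<^sup>2)"
      unfolding y_def by (simp add: field_simps)
    also have "\<dots> \<ge> M * (T\<^sup>2 / 2) - 5 * (1 / 5)"
      using Mh by (simp add: power2_eq_square)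
    finally show ?thesis by simp
  qed
  have "4 * (1 / 2) \<le> M * (1 - 10 * h)"
    using M h_le h_pos by (intro mult_mono) auto
  then have "2 * 1 \<le> M * (1 - 10 * h) * T\<^sup>2"
    using T2 by (intro mult_mono) auto
  then have "1 \<le> y" unfolding y_def by simp
  then have "2 \<le> exp y" using exp_ge_add_one_self[of y] by linarith
  then have half: "exp y / 2 \<le> exp y - 1" by simp
  have "exp (M * (T\<^sup>2 / 2 - 1) - 1) / (8 * M) = exp (- M) / (4 * M) * (exp (M * (T\<^sup>2 / 2) - 1) / 2)"
    by (simp add: field_simps flip: exp_add)
  also have "\<dots> \<le> exp (- M) / (4 * M) * (exp y / 2)"
    using y M by (intro mult_left_mono divide_right_mono) auto
  also have "\<dots> \<le> exp (- M) / (4 * M) * (exp y - 1)"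
    using half M by (intro mult_left_mono) auto
  also have "\<dots> \<le> \<gamma> T"
    unfolding y_def by (rule \<gamma>_lower_closed) (use T in \<open>auto simp: T_def\<close>)
  finally show ?thesis by (simp add: T_def)
qed

text \<open>A floor for \<gamma> from \<open>sqrt 2 + x\<close> to 2. Since
  \<open>exp (M * x) = 1 / h\<close>, it equals \<open>1 / h\<close> up to the factor
  \<open>exp (- 2) / (8 * M)\<close>.\<close>

definition L :: real where
  "L = exp (M * x - 2) / (8 * M)"

text \<open>After \<open>T\<close> there is no control of \<open>a\<close>, but \<beta> can fall
  only at rate \<open>h\<close>, so it stays above \<open>T - 20 * h\<close> and \<gamma> keeps
  growing exponentially at rate at least \<open>p\<close>. Over a time of at least
  \<open>2 * x\<close> this outweighs the deficit in the exponent at \<open>T\<close>.\<close>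

lemma \<gamma>_lower_open:
  assumes "sqrt 2 + x \<le> t" "t \<le> 2"
  shows "\<gamma> t \<ge> L"
proof -
  define T where "T = sqrt 2 - x"
  define p where "p = M * (T - 20 * h)"
  have T: "1 \<le> T" "T \<le> 142 / 100" "T \<le> t" using x sqrt2_bounds assms by (auto simp: T_def)
  have \<gamma>T: "\<gamma> T \<ge> exp (M * (T\<^sup>2 / 2 - 1) - 1) / (8 * M)"
    using \<gamma>_lower_at_threshold by (simp add: T_def)
  have \<beta>T: "\<beta> T \<ge> \<beta> 0 + (1 - 9 * h - h) * (T - 0)"
    by (rule \<beta>_growth) (use T gate_closed(1) in \<open>auto simp: T_def algebra_simps\<close>)
  then have \<beta>T': "\<beta> T \<ge> T - 10 * (h * T)"
    by (simp add: init algebra_simps)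
  have hT: "h * T \<le> h * (142 / 100)" using T h_pos by (intro mult_left_mono) auto
  have "\<gamma> t - \<gamma> T * exp (p * (t - T)) \<ge> 0"
  proof (rule nonneg_of_linear_differential_inequality[where x = T and S = "{0..}"
        and f = "\<lambda>t. \<gamma> t - \<gamma> T * exp (p * (t - T))" and p = "\<lambda>t. p"
        and f' = "\<lambda>t. exp (- M) * (a t) ^ 2 + M * \<beta> t * \<gamma> t - \<gamma> T * (p * exp (p * (t - T)))"])
    fix u assume u: "u \<in> {T..t}"
    then have u0: "u \<ge> 0" using T by simp
    show "((\<lambda>t. \<gamma> t - \<gamma> T * exp (p * (t - T))) has_real_derivative
        exp (- M) * (a u) ^ 2 + M * \<beta> u * \<gamma> u - \<gamma> T * (p * exp (p * (u - T)))) (at u within {0..})"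
      by (rule derivative_eq_intros refl derivs[OF u0] | simp)+
    have "\<beta> u \<ge> \<beta> T + (0 - h) * (u - T)"
      by (rule \<beta>_growth) (use u T assms in auto)
    then have "\<beta> u \<ge> \<beta> T - h * (u - T)" by simp
    moreover have "h * (u - T) \<le> h * 2" using u T assms h_pos by (intro mult_left_mono) auto
    ultimately have "T - 20 * h \<le> \<beta> u"
      using \<beta>T' hT h_pos by linarith
    then have "M * (T - 20 * h) \<le> M * \<beta> u"
      using M by (intro mult_left_mono) auto
    then have "p * \<gamma> u \<le> M * \<beta> u * \<gamma> u"
      unfolding p_def using \<gamma>_nonneg[OF u0] by (intro mult_right_mono) auto
    moreover have "0 \<le> exp (- M) * (a u)\<^sup>2" by simp
    moreover have "p * (\<gamma> u - \<gamma> T * exp (p * (u - T))) = p * \<gamma> u - \<gamma> T * (p * exp (p * (u - T)))"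
      by (simp add: algebra_simps)
    ultimately show "p * (\<gamma> u - \<gamma> T * exp (p * (u - T)))
        \<le> exp (- M) * (a u) ^ 2 + M * \<beta> u * \<gamma> u - \<gamma> T * (p * exp (p * (u - T)))"
      by linarith
  qed (use T in auto)
  then have grow: "\<gamma> T * exp (p * (t - T)) \<le> \<gamma> t" by simp
  have "p * (2 * x) \<le> p * (t - T)"
    unfolding p_def using M T h_le assms
    by (intro mult_left_mono mult_nonneg_nonneg) (auto simp: T_def)
  moreover have "M * x - 2 \<le> M * (T\<^sup>2 / 2 - 1) - 1 + p * (2 * x)"
  proof -
    \<comment> \<open>The net gain in the exponent beyond \<open>M * x\<close>; it is nonnegative,
      by a narrow margin, for \<open>x \<le> 1 / 4\<close>.\<close>
    have "0 \<le> (M * x) * (sqrt 2 - 1 - 3 / 2 * x)"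
      using M x sqrt2_bounds by (intro mult_nonneg_nonneg) auto
    also have "\<dots> = M * (T\<^sup>2 / 2 - 1) + M * T * (2 * x) - M * x"
      by (simp add: T_def power2_eq_square field_simps)
    finally have "M * x \<le> M * (T\<^sup>2 / 2 - 1) + M * T * (2 * x)" by simp
    moreover have "(20 * M * h) * (2 * x) \<le> 1 * (1 / 2)"
      using h_small x M h_pos by (intro mult_mono) auto
    ultimately show ?thesis unfolding p_def by (simp add: algebra_simps)
  qed
  ultimately have "M * x - 2 \<le> (M * (T\<^sup>2 / 2 - 1) - 1) + p * (t - T)" by linarith
  then have "L \<le> exp ((M * (T\<^sup>2 / 2 - 1) - 1) + p * (t - T)) / (8 * M)"
    unfolding L_def using M by (intro divide_right_mono) auto
  also have "\<dots> = exp (M * (T\<^sup>2 / 2 - 1) - 1) / (8 * M) * exp (p * (t - T))"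
    by (simp add: exp_add)
  also have "\<dots> \<le> \<gamma> T * exp (p * (t - T))"
    using \<gamma>T by (intro mult_right_mono) auto
  finally show ?thesis using grow by linarith
qed

section \<open>The open gate: relaxation of \<open>w\<close> towards 1\<close>

text \<open>These are the terms of the equation for \<open>a\<close> other than the rotation. The
  crude bound 1 suffices, since \<open>gate_open\<close> divides them by \<gamma>.\<close>

lemma a_forcing_small:
  assumes "0 \<le> t" "t \<le> 2"
  shows "\<bar>e ^ 2 * a t * \<beta> t + e ^ 4 * exp (- M) * a t * \<gamma> t\<bar> \<le> 1"
proof -
  have q: "exp (- M) ^ n \<le> (1 / 2) ^ n" for n
    using exp_M_bounds by (intro power_mono) auto
  have e1: "e \<le> 1 / 16" using e_le q[of 4] by (simp add: eval_nat_numeral)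
  have "e * \<gamma> t \<le> 1 / 4" using e_\<gamma>_small[OF assms] q[of 3] by (simp add: eval_nat_numeral)
  then have "(e ^ 3 * exp (- M)) * (e * \<gamma> t) \<le> 1 * (1 / 4)"
    using e e1 \<gamma>_nonneg[OF assms(1)] M
    by (intro mult_mono mult_le_one power_le_one) auto
  then have 1: "e ^ 4 * exp (- M) * \<gamma> t \<le> 1 / 4"
    by (simp add: eval_nat_numeral mult_ac)
  have "e ^ 2 \<le> (1 / 16) ^ 2" using e e1 by (intro power_mono) auto
  then have 2: "e ^ 2 * \<bar>\<beta> t\<bar> \<le> (1 / 16) ^ 2 * 2"
    using \<beta>_abs_le[OF assms] by (intro mult_mono) auto
  have "\<bar>a t * (e ^ 2 * \<beta> t + e ^ 4 * exp (- M) * \<gamma> t)\<bar>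
      \<le> 1 * \<bar>e ^ 2 * \<beta> t + e ^ 4 * exp (- M) * \<gamma> t\<bar>"
    unfolding abs_mult using abs_le_1[OF assms(1)] by (intro mult_right_mono) auto
  also have "\<dots> \<le> e ^ 2 * \<bar>\<beta> t\<bar> + e ^ 4 * exp (- M) * \<gamma> t"
    using \<gamma>_nonneg[OF assms(1)] abs_triangle_ineq[of "e ^ 2 * \<beta> t" "e ^ 4 * exp (- M) * \<gamma> t"]
    by (simp add: abs_mult)
  also have "\<dots> \<le> 1" using 1 2 by (simp add: power2_eq_square)
  finally show ?thesis by (simp add: algebra_simps)
qed

text \<open>Once \<open>\<gamma>\<close> is huge, \<open>a\<close> and \<open>d\<close> rotate into each other so fast that \<open>d\<^sup>2\<close> may be replaced by
  its average \<open>(a\<^sup>2 + d\<^sup>2) / 2\<close>; the corrector \<open>K / 2 * a * d / \<gamma>\<close> makes this exact up to \<open>1 / L\<close>.\<close>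

lemma gate_open:
  assumes KL: "K \<le> L" and t: "sqrt 2 + x \<le> t" "t \<le> 2"
  shows "1 - w t \<le> (2 + 3 * K + 2 * M) / L + h + 2 * exp (- (K * (t - (sqrt 2 + x)) / 2))"
proof -
  define T where "T = sqrt 2 + x"
  have T: "0 \<le> T" "T \<le> t" using t x by (auto simp: T_def)
  have L1: "1 \<le> L" using KL K by simp
  define F where "F t = w t + K / 2 * (a t * d t / \<gamma> t)" for t
  \<comment> \<open>The total error: \<open>(2 + K + 2 * M) / L\<close> from the derivative of the
    corrector, \<open>K / L\<close> for replacing \<open>w\<close> by \<open>F\<close>, and
    \<open>h\<close> for the energy in \<open>b\<close> and \<open>c\<close>.\<close>
  define \<rho> where "\<rho> = (2 + 2 * K + 2 * M) / L + h"
  define A where "A t = - (\<gamma> t * d t) - e ^ 2 * a t * \<beta> t - e ^ 4 * exp (- M) * a t * \<gamma> t" for t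
  define D where "D t = \<gamma> t * a t - K * d t * w t" for t
  define G where "G t = exp (- M) * (a t) ^ 2 + M * \<beta> t * \<gamma> t" for t
  define F' where
    "F' t = K * (d t)\<^sup>2 + K / 2 * ((A t * d t + a t * D t) / \<gamma> t - a t * d t * G t / (\<gamma> t)\<^sup>2)" for t
  have \<gamma>L: "\<gamma> u \<ge> L" if "u \<in> {T..t}" for u
    using \<gamma>_lower_open[of u] that t by (auto simp: T_def)
  have ad: "\<bar>a u * d u\<bar> \<le> 1" if "u \<ge> 0" for u
    unfolding abs_mult using abs_le_1[OF that] by (intro mult_le_one) auto
  have F_w: "\<bar>F u - w u\<bar> \<le> K / (2 * L)" if u: "u \<in> {T..t}" for u
  proof -
    have "\<bar>a u * d u / \<gamma> u\<bar> = \<bar>a u * d u\<bar> / \<gamma> u"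
      using \<gamma>L[OF u] L1 by (simp add: abs_divide)
    also have "\<dots> \<le> 1 / L"
      using \<gamma>L[OF u] L1 ad[of u] u T by (intro frac_le) auto
    finally have "K / 2 * \<bar>a u * d u / \<gamma> u\<bar> \<le> K / 2 * (1 / L)"
      using K by (intro mult_left_mono) auto
    then show ?thesis using K by (simp add: F_def abs_mult)
  qed
  have F'_ge: "F' u \<ge> K / 2 * (1 - \<rho> - F u)" if u: "u \<in> {T..t}" for u
  proof -
    have u0: "0 \<le> u" "u \<le> 2" using u T t by auto
    have g: "\<gamma> u \<ge> L" "\<gamma> u > 0" "\<gamma> u \<ge> 1" using \<gamma>L[OF u] L1 by auto
    \<comment> \<open>What remains of the derivative of \<open>a * d\<close> once the rotation terms
      \<open>\<gamma> * (a^2 - d^2)\<close> are removed.\<close>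
    define \<delta> where "\<delta> = - (e ^ 2 * a u * \<beta> u + e ^ 4 * exp (- M) * a u * \<gamma> u) * d u - K * (a u * d u) * w u"
    have "\<bar>(e ^ 2 * a u * \<beta> u + e ^ 4 * exp (- M) * a u * \<gamma> u) * d u\<bar> \<le> 1"
      unfolding abs_mult[of _ "d u"] using a_forcing_small[OF u0] abs_le_1[OF u0(1)]
      by (intro mult_le_one) auto
    moreover have "\<bar>K * (a u * d u) * w u\<bar> \<le> K * 1 * 1"
      unfolding abs_mult[of _ "w u"] abs_mult[of K] using ad[OF u0(1)] abs_le_1[OF u0(1)] K
      by (intro mult_mono) auto
    ultimately have "\<bar>\<delta>\<bar> \<le> 1 + K" unfolding \<delta>_def by linarith
    then have "\<bar>\<delta>\<bar> / \<gamma> u \<le> (1 + K) / L"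
      using g L1 by (intro frac_le) auto
    then have "\<bar>\<delta> / \<gamma> u\<bar> \<le> (1 + K) / L" using g by simp
    then have \<delta>: "\<delta> / \<gamma> u \<ge> - ((1 + K) / L)" by linarith
    have "A u * d u + a u * D u = \<gamma> u * ((a u)\<^sup>2 - (d u)\<^sup>2) + \<delta>"
      unfolding A_def D_def \<delta>_def by (simp add: algebra_simps power2_eq_square)
    then have "(A u * d u + a u * D u) / \<gamma> u = (a u)\<^sup>2 - (d u)\<^sup>2 + \<delta> / \<gamma> u"
      using g by (simp add: field_simps)
    then have 1: "(A u * d u + a u * D u) / \<gamma> u \<ge> (a u)\<^sup>2 - (d u)\<^sup>2 - (1 + K) / L"
      using \<delta> by linarith
    \<comment> \<open>As \<open>\<gamma> \<ge> 1\<close>, the source is absorbed and the derivative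
      \<open>G\<close> of \<gamma> is at most \<open>(1 + 2 * M) * \<gamma>\<close> in absolute
      value; differentiating \<open>1 / \<gamma>\<close> thus costs only order
      \<open>M / L\<close>.\<close>
    have "\<bar>exp (- M) * (a u) ^ 2\<bar> \<le> \<gamma> u"
    proof -
      have "exp (- M) * (a u) ^ 2 \<le> 1"
        using M squares_le_1[OF u0(1)] by (intro mult_le_one) auto
      then show ?thesis using g by simp
    qed
    moreover have "\<bar>M * \<beta> u * \<gamma> u\<bar> \<le> M * 2 * \<gamma> u"
      unfolding abs_mult using \<beta>_abs_le[OF u0] M g by (intro mult_mono) auto
    ultimately have "\<bar>G u\<bar> \<le> \<gamma> u + M * 2 * \<gamma> u" unfolding G_def by linarith
    then have "\<bar>G u\<bar> \<le> (1 + 2 * M) * \<gamma> u" by (simp add: algebra_simps)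
    then have "\<bar>a u * d u\<bar> * \<bar>G u\<bar> \<le> 1 * ((1 + 2 * M) * \<gamma> u)"
      using ad[OF u0(1)] by (intro mult_mono) auto
    then have "\<bar>a u * d u * G u\<bar> / (\<gamma> u)\<^sup>2 \<le> ((1 + 2 * M) * \<gamma> u) / (\<gamma> u)\<^sup>2"
      by (intro divide_right_mono) (auto simp: abs_mult)
    also have "\<dots> = (1 + 2 * M) / \<gamma> u" using g by (simp add: power2_eq_square)
    also have "\<dots> \<le> (1 + 2 * M) / L" using g L1 M by (intro frac_le) auto
    finally have "\<bar>a u * d u * G u / (\<gamma> u)\<^sup>2\<bar> \<le> (1 + 2 * M) / L" by simp
    then have "(A u * d u + a u * D u) / \<gamma> u - a u * d u * G u / (\<gamma> u)\<^sup>2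
        \<ge> (a u)\<^sup>2 - (d u)\<^sup>2 - (1 + K) / L - (1 + 2 * M) / L"
      using 1 by linarith
    then have "F' u \<ge> K * (d u)\<^sup>2 + K / 2 * ((a u)\<^sup>2 - (d u)\<^sup>2 - (1 + K) / L - (1 + 2 * M) / L)"
      unfolding F'_def using K by (intro add_left_mono mult_left_mono) auto
    also have "K * (d u)\<^sup>2 + K / 2 * ((a u)\<^sup>2 - (d u)\<^sup>2 - (1 + K) / L - (1 + 2 * M) / L)
        = K / 2 * ((a u)\<^sup>2 + (d u)\<^sup>2 - (2 + K + 2 * M) / L)"
      using L1 by (simp add: field_simps)
    finally have 2: "F' u \<ge> K / 2 * ((a u)\<^sup>2 + (d u)\<^sup>2 - (2 + K + 2 * M) / L)" .
    \<comment> \<open>Replacing \<open>1 - w^2\<close> by the smaller \<open>1 - w\<close> makes the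
      inequality linear, at the price of half the decay rate near 1.\<close>
    have "(w u)\<^sup>2 \<le> w u * 1"
      unfolding power2_eq_square using abs_le_1[OF u0(1)] w_nonneg[OF u0(1)]
      by (intro mult_left_mono) auto
    then have "(a u)\<^sup>2 + (d u)\<^sup>2 \<ge> 1 - w u - h"
      using energy[OF u0(1)] b_c_small[OF u0] by linarith
    moreover have "K / (2 * L) \<le> K / L" using K L1 by (simp add: field_simps)
    moreover have "\<rho> = (2 + K + 2 * M) / L + K / L + h"
      unfolding \<rho>_def using L1 by (simp add: field_simps)
    ultimately have "1 - \<rho> - F u \<le> (a u)\<^sup>2 + (d u)\<^sup>2 - (2 + K + 2 * M) / L"
      using F_w[OF u] by linarith
    then have "K / 2 * (1 - \<rho> - F u) \<le> K / 2 * ((a u)\<^sup>2 + (d u)\<^sup>2 - (2 + K + 2 * M) / L)"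
      using K by (intro mult_left_mono) auto
    then show ?thesis using 2 by linarith
  qed
  \<comment> \<open>The factor 2 serves the start: \<open>F T \<ge> - 1\<close>, because
    \<open>w\<close> is nonnegative and \<open>K \<le> L\<close> keeps the corrector below
    1.\<close>
  have "F t - (1 - \<rho>) + 2 * exp (- (K * (t - T) / 2)) \<ge> 0"
  proof (rule nonneg_of_linear_differential_inequality[where x = T and S = "{0..}"
        and f = "\<lambda>t. F t - (1 - \<rho>) + 2 * exp (- (K * (t - T) / 2))" and p = "\<lambda>_. - (K / 2)"
        and f' = "\<lambda>t. F' t - K * exp (- (K * (t - T) / 2))"])
    fix u assume u: "u \<in> {T..t}"
    then have u0: "u \<ge> 0" using T by simp
    have g: "\<gamma> u \<noteq> 0" using \<gamma>L[OF u] L1 by auto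
    have F: "(F has_real_derivative F' u) (at u within {0..})"
      unfolding F_def
      by (rule derivative_eq_intros refl derivs[OF u0] g)+
        (use g in \<open>simp add: F'_def A_def D_def G_def field_simps power2_eq_square\<close>)
    show "((\<lambda>t. F t - (1 - \<rho>) + 2 * exp (- (K * (t - T) / 2))) has_real_derivative
        F' u - K * exp (- (K * (u - T) / 2))) (at u within {0..})"
      by (rule derivative_eq_intros refl F | simp)+
    show "- (K / 2) * (F u - (1 - \<rho>) + 2 * exp (- (K * (u - T) / 2)))
        \<le> F' u - K * exp (- (K * (u - T) / 2))"
      using F'_ge[OF u] by (simp add: field_simps)
  next
    have "K / (2 * L) \<le> 1" using KL L1 by (simp add: field_simps)
    moreover have "\<rho> \<ge> 0" unfolding \<rho>_def using K M L1 h_pos by simp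
    ultimately show "0 \<le> F T - (1 - \<rho>) + 2 * exp (- (K * (T - T) / 2))"
      using F_w[of T] T w_nonneg[of T] by simp
  qed (use T in auto)
  moreover have "F t \<le> w t + K / (2 * L)" using F_w[of t] T by auto
  moreover have "K / (2 * L) \<le> K / L" using K L1 by (simp add: field_simps)
  moreover have "(2 + 3 * K + 2 * M) / L + h = \<rho> + K / L"
    unfolding \<rho>_def using L1 by (simp add: field_simps)
  ultimately show ?thesis unfolding T_def by linarith
qed

end

section \<open>Return to the original variables and choice of constants\<close>

text \<open>Dividing \<open>b\<close> by \<open>e\<close> and \<open>c\<close> by
  \<open>e ^ 2\<close> removes every negative power of \<open>e\<close> from the system.\<close>

lemma rescaled_gate_of_gate_solution:
  assumes sol: "gate_solution K e a b c d a'"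
    and "K \<ge> 1" "K ^ 10 \<ge> 4" "0 < e" "e \<le> exp (- (4 * K ^ 10))" "0 < x" "x \<le> 1 / 4"
      "20 * K ^ 10 * exp (- (K ^ 10 * x)) \<le> 1"
  shows "rescaled_gate K (K ^ 10) e x (exp (- (K ^ 10 * x))) a (\<lambda>t. b t / e) (\<lambda>t. c t / e ^ 2) d a'"
proof
  fix t :: real assume t: "t \<ge> 0"
  have der:
    "(a has_real_derivative - (c t * d t / e ^ 2) - e * a t * b t - e ^ 2 * exp (- (K ^ 10)) * a t * c t)
      (at t within {0..})"
    "(b has_real_derivative e * (a t) ^ 2 - K ^ 10 / e * (c t) ^ 2) (at t within {0..})"
    "(c has_real_derivative e ^ 2 * exp (- (K ^ 10)) * (a t) ^ 2 + K ^ 10 / e * b t * c t)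
      (at t within {0..})"
    "(d has_real_derivative c t * a t / e ^ 2 - K * d t * a' t) (at t within {0..})"
    "(a' has_real_derivative K * (d t) ^ 2) (at t within {0..})"
    using sol t unfolding gate_solution_def by auto
  show "(a has_real_derivative - (c t / e ^ 2 * d t) - e ^ 2 * a t * (b t / e)
      - e ^ 4 * exp (- (K ^ 10)) * a t * (c t / e ^ 2)) (at t within {0..})"
    by (rule DERIV_cong[OF der(1)])
      (use \<open>0 < e\<close> in \<open>simp add: power2_eq_square power4_eq_xxxx\<close>)
  show "((\<lambda>t. b t / e) has_real_derivative (a t)\<^sup>2 - e ^ 2 * K ^ 10 * (c t / e ^ 2)\<^sup>2)
      (at t within {0..})"
    by (rule DERIV_cong[OF DERIV_cdivide[OF der(2)]])
      (use \<open>0 < e\<close> in \<open>simp add: field_simps power2_eq_square\<close>)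
  show "((\<lambda>t. c t / e ^ 2) has_real_derivative
      exp (- (K ^ 10)) * (a t)\<^sup>2 + K ^ 10 * (b t / e) * (c t / e ^ 2)) (at t within {0..})"
    by (rule DERIV_cong[OF DERIV_cdivide[OF der(3)]])
      (use \<open>0 < e\<close> in \<open>simp add: field_simps power2_eq_square\<close>)
  show "(d has_real_derivative c t / e ^ 2 * a t - K * d t * a' t) (at t within {0..})"
    using der(4) by simp
  show "(a' has_real_derivative K * (d t)\<^sup>2) (at t within {0..})"
    by (fact der(5))
qed (use assms in \<open>auto simp: gate_solution_def\<close>)

text \<open>Here \<open>s\<close> is \<open>sqrt K\<close>, so \<open>M = s ^ 20\<close> and, for
  \<open>x = 1 / (4 * s)\<close>, \<open>h = exp (- (s ^ 19 / 4))\<close>. After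
  \<open>s \<ge> 2\<close> the conjuncts are \<open>h_small\<close>, the error of
  \<open>gate_closed\<close>, \<open>K \<le> L\<close> and the error of \<open>gate_open\<close>.
  The targets are of order \<open>s ^ 40 = (K ^ 10)^2\<close> in the denominator since energy
  controls squares.\<close>

lemma eventually_error_terms_small:
  "eventually (\<lambda>s::real. s \<ge> 2 \<and> 20 * s ^ 20 * exp (- (s ^ 19 / 4)) \<le> 1 \<and>
      9 * exp (- (s ^ 19 / 4)) \<le> 1 / s ^ 40 \<and>
      s ^ 2 \<le> exp (s ^ 19 / 4 - 2) / (8 * s ^ 20) \<and>
      (2 + 3 * s ^ 2 + 2 * s ^ 20) / (exp (s ^ 19 / 4 - 2) / (8 * s ^ 20)) + exp (- (s ^ 19 / 4))
        + 2 * exp (- (3 * s / 8)) \<le> 1 / (2 * s ^ 40)) at_top"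
  by (intro eventually_conj; real_asymp)

theorem theorem5p3:
  "\<exists>Kstar A :: real. Kstar \<ge> 1 \<and> A > 0 \<and>
     (\<forall>K\<ge>Kstar. \<exists>estar>0. \<forall>e. 0 < e \<and> e \<le> estar \<longrightarrow>
       (\<forall>a b c d a'. gate_solution K e a b c d a' \<longrightarrow>
         (\<exists>tc. \<bar>tc - sqrt 2\<bar> \<le> A / sqrt K \<and>
           (\<forall>t. 0 \<le> t \<and> t \<le> tc - 1 / sqrt K \<longrightarrow>
              \<bar>a t - 1\<bar> \<le> A / K ^ 10 \<and> \<bar>b t\<bar> \<le> A / K ^ 10 \<and> \<bar>c t\<bar> \<le> A / K ^ 10 \<and>
              \<bar>d t\<bar> \<le> A / K ^ 10 \<and> \<bar>a' t\<bar> \<le> A / K ^ 10) \<and>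
           (\<forall>t. t \<ge> tc + 1 / sqrt K \<longrightarrow>
              \<bar>a' t - 1\<bar> \<le> A / K ^ 10 \<and> \<bar>a t\<bar> \<le> A / K ^ 10 \<and> \<bar>b t\<bar> \<le> A / K ^ 10 \<and>
              \<bar>c t\<bar> \<le> A / K ^ 10 \<and> \<bar>d t\<bar> \<le> A / K ^ 10))))"
proof -
  obtain s0 :: real where s0: "\<And>s. s \<ge> s0 \<Longrightarrow> s \<ge> 2 \<and> 20 * s ^ 20 * exp (- (s ^ 19 / 4)) \<le> 1 \<and>
      9 * exp (- (s ^ 19 / 4)) \<le> 1 / s ^ 40 \<and>
      s ^ 2 \<le> exp (s ^ 19 / 4 - 2) / (8 * s ^ 20) \<and>
      (2 + 3 * s ^ 2 + 2 * s ^ 20) / (exp (s ^ 19 / 4 - 2) / (8 * s ^ 20)) + exp (- (s ^ 19 / 4))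
        + 2 * exp (- (3 * s / 8)) \<le> 1 / (2 * s ^ 40)"
    using eventually_error_terms_small unfolding eventually_at_top_linorder by blast
  \<comment> \<open>Everything holds with \<open>A = 1\<close> and \<open>tc = sqrt 2\<close>; the
    bound on \<open>e\<close> required here becomes \<open>estar\<close>.\<close>
  have transition: "\<exists>tc. \<bar>tc - sqrt 2\<bar> \<le> 1 / sqrt K \<and>
           (\<forall>t. 0 \<le> t \<and> t \<le> tc - 1 / sqrt K \<longrightarrow>
              \<bar>a t - 1\<bar> \<le> 1 / K ^ 10 \<and> \<bar>b t\<bar> \<le> 1 / K ^ 10 \<and> \<bar>c t\<bar> \<le> 1 / K ^ 10 \<and>
              \<bar>d t\<bar> \<le> 1 / K ^ 10 \<and> \<bar>a' t\<bar> \<le> 1 / K ^ 10) \<and>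
           (\<forall>t. t \<ge> tc + 1 / sqrt K \<longrightarrow>
              \<bar>a' t - 1\<bar> \<le> 1 / K ^ 10 \<and> \<bar>a t\<bar> \<le> 1 / K ^ 10 \<and> \<bar>b t\<bar> \<le> 1 / K ^ 10 \<and>
              \<bar>c t\<bar> \<le> 1 / K ^ 10 \<and> \<bar>d t\<bar> \<le> 1 / K ^ 10)"
    if K: "K \<ge> (max 1 s0)\<^sup>2" and e: "0 < e" "e \<le> exp (- (4 * K ^ 10))"
      and sol: "gate_solution K e a b c d a'"
    for K e :: real and a b c d a'
  proof -
    define s where "s = sqrt K"
    have "s \<ge> s0" using real_le_rsqrt[OF K] by (simp add: s_def)
    note N = s0[OF this]
    have s: "s \<ge> 2" using N by simp
    have "1 \<le> (max 1 s0)\<^sup>2" by (intro one_le_power) simp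
    then have K1: "K \<ge> 1" using K by linarith
    have Ks: "K = s\<^sup>2" using K1 by (simp add: s_def)
    have K10: "K ^ 10 = s ^ 20" and K20: "(1 / K ^ 10)\<^sup>2 = 1 / s ^ 40"
      unfolding Ks by (simp_all add: power_divide flip: power_mult)
    \<comment> \<open>A quarter of \<open>1 / sqrt K\<close>: the other three quarters are left for
      \<open>w\<close> to relax, which yields the exponent \<open>3 * s / 8\<close>.\<close>
    define x where "x = 1 / (4 * s)"
    have Mx: "s ^ 20 * x = s ^ 19 / 4"
      using s by (simp add: x_def eval_nat_numeral)
    have x: "0 < x" "x \<le> 1 / 4" using s by (auto simp: x_def field_simps)
    have "2 ^ 20 \<le> s ^ 20" using s by (intro power_mono) auto
    then have M4: "s ^ 20 \<ge> 4" by simp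
    define h where h_eq: "h = exp (- (s ^ 19 / 4))"
    interpret rescaled_gate K "K ^ 10" e x h a "\<lambda>t. b t / e" "\<lambda>t. c t / e ^ 2" d a'
      using rescaled_gate_of_gate_solution[OF sol K1 _ e x] M4 N by (simp add: K10 Mx h_eq)
    have energy': "(a t)\<^sup>2 + (b t)\<^sup>2 + (c t)\<^sup>2 + (d t)\<^sup>2 + (a' t)\<^sup>2 = 1" if "t \<ge> 0" for t
      using energy[OF that] e by (simp add: power_divide flip: power_mult)
    have sq: "\<bar>z\<bar> \<le> 1 / K ^ 10" if "z\<^sup>2 \<le> 1 / s ^ 40" for z :: real
      using that K1 by (intro abs_le_square_iff[THEN iffD2, of z "1 / K ^ 10", simplified])
        (simp_all add: K20)
    show ?thesis
    proof (rule exI[of _ "sqrt 2"], intro conjI allI impI; (elim conjE)?)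
      show "\<bar>sqrt 2 - sqrt 2\<bar> \<le> 1 / sqrt K" using K1 by simp
    next
      fix t assume t: "0 \<le> t" "t \<le> sqrt 2 - 1 / sqrt K"
      have "x \<le> 1 / sqrt K" unfolding x_def s_def[symmetric] using s by (intro frac_le) auto
      then have t': "t \<le> sqrt 2 - x" using t by linarith
      have sum: "(b t)\<^sup>2 + (c t)\<^sup>2 + (d t)\<^sup>2 + (a' t)\<^sup>2 \<le> 1 / s ^ 40"
        using gate_closed(1)[OF t(1) t'] energy'[OF t(1)] N by (simp add: h_eq)
      show "\<bar>b t\<bar> \<le> 1 / K ^ 10" "\<bar>c t\<bar> \<le> 1 / K ^ 10" "\<bar>d t\<bar> \<le> 1 / K ^ 10" "\<bar>a' t\<bar> \<le> 1 / K ^ 10"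
        using sum zero_le_power2[of "b t"] zero_le_power2[of "c t"] zero_le_power2[of "d t"]
          zero_le_power2[of "a' t"] by (intro sq; linarith)+
      have "s ^ 20 \<le> s ^ 40" using s by (intro power_increasing) auto
      then have "1 / s ^ 40 \<le> 1 / K ^ 10" unfolding K10 using s by (intro frac_le) auto
      then show "\<bar>a t - 1\<bar> \<le> 1 / K ^ 10"
        using gate_closed(2)[OF t(1) t'] abs_le_1(1)[OF t(1)] N by (simp add: h_eq)
    next
      fix t assume t: "t \<ge> sqrt 2 + 1 / sqrt K"
      \<comment> \<open>The bounds on \<beta> and \<gamma> reach only to time 2, so
        \<open>gate_open\<close> is applied once, at \<open>t0 \<le> 2\<close>; monotonicity of
        \<open>a'\<close> carries the result to all later times.\<close>
      define t0 where "t0 = sqrt 2 + 1 / s"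
      have "1 / s \<le> 1 / 2" "x \<le> 1 / s" using s by (auto simp: x_def field_simps)
      then have t0: "sqrt 2 + x \<le> t0" "t0 \<le> 2" "0 \<le> t0" "t0 \<le> t"
        using sqrt2_bounds t x by (auto simp: t0_def s_def)
      have L: "L = exp (s ^ 19 / 4 - 2) / (8 * s ^ 20)"
        using L_def by (simp add: K10 Mx)
      have Kt0: "K * (t0 - (sqrt 2 + x)) / 2 = 3 * s / 8"
        using s by (simp add: Ks t0_def x_def field_simps power2_eq_square)
      have "1 - a' t0 \<le> 1 / (2 * s ^ 40)"
        using gate_open[OF _ t0(1,2)] N
        unfolding L Kt0 unfolding K10 h_eq unfolding Ks by linarith
      then have a'_ge: "1 - a' t \<le> 1 / (2 * s ^ 40)"
        using w_mono[OF t0(3,4)] by linarith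
      have t_nonneg: "t \<ge> 0" using t0 by linarith
      \<comment> \<open>Equivalent to \<open>1 - a'^2 \<le> 2 * (1 - a')\<close>, which explains the
        factor 2 in the denominator of the bound on \<open>1 - a'\<close>.\<close>
      have "2 * a' t - 1 \<le> (a' t)\<^sup>2"
        using zero_le_power2[of "a' t - 1"] by (simp add: power2_eq_square algebra_simps)
      then have sum: "(a t)\<^sup>2 + (b t)\<^sup>2 + (c t)\<^sup>2 + (d t)\<^sup>2 \<le> 1 / s ^ 40"
        using a'_ge energy'[OF t_nonneg] by simp
      show "\<bar>a t\<bar> \<le> 1 / K ^ 10" "\<bar>b t\<bar> \<le> 1 / K ^ 10" "\<bar>c t\<bar> \<le> 1 / K ^ 10" "\<bar>d t\<bar> \<le> 1 / K ^ 10"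
        using sum zero_le_power2[of "b t"] zero_le_power2[of "c t"] zero_le_power2[of "d t"]
          zero_le_power2[of "a t"] by (intro sq; linarith)+
      have "s ^ 20 \<le> s ^ 40" using s by (intro power_increasing) auto
      also have "\<dots> \<le> 2 * s ^ 40" using s by simp
      finally have "1 / (2 * s ^ 40) \<le> 1 / K ^ 10" unfolding K10 using s by (intro frac_le) auto
      then show "\<bar>a' t - 1\<bar> \<le> 1 / K ^ 10"
        using a'_ge abs_le_1(3)[OF t_nonneg] by linarith
    qed
  qed
  show ?thesis
  proof (rule exI[of _ "(max 1 s0)\<^sup>2"], rule exI[of _ 1], intro conjI allI impI)
    show "1 \<le> (max 1 s0)\<^sup>2" by (intro one_le_power) simp
    show "0 < (1::real)" by simp
    fix K :: real assume K: "(max 1 s0)\<^sup>2 \<le> K"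
    show "\<exists>estar>0. \<forall>e. 0 < e \<and> e \<le> estar \<longrightarrow>
       (\<forall>a b c d a'. gate_solution K e a b c d a' \<longrightarrow>
         (\<exists>tc. \<bar>tc - sqrt 2\<bar> \<le> 1 / sqrt K \<and>
           (\<forall>t. 0 \<le> t \<and> t \<le> tc - 1 / sqrt K \<longrightarrow>
              \<bar>a t - 1\<bar> \<le> 1 / K ^ 10 \<and> \<bar>b t\<bar> \<le> 1 / K ^ 10 \<and> \<bar>c t\<bar> \<le> 1 / K ^ 10 \<and>
              \<bar>d t\<bar> \<le> 1 / K ^ 10 \<and> \<bar>a' t\<bar> \<le> 1 / K ^ 10) \<and>
           (\<forall>t. t \<ge> tc + 1 / sqrt K \<longrightarrow>
              \<bar>a' t - 1\<bar> \<le> 1 / K ^ 10 \<and> \<bar>a t\<bar> \<le> 1 / K ^ 10 \<and> \<bar>b t\<bar> \<le> 1 / K ^ 10 \<and>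
              \<bar>c t\<bar> \<le> 1 / K ^ 10 \<and> \<bar>d t\<bar> \<le> 1 / K ^ 10)))"
      by (rule exI[of _ "exp (- (4 * K ^ 10))"], rule conjI[OF exp_gt_zero], intro allI impI,
          elim conjE, rule transition[OF K])
  qed
qed

end
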